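(* Let $k$ be a field of prime characteristic $p$, let $n$ be an integer that is greater than $1$ and not divisible by $p$, and let $R:=k[[x,y]]/(x^n-y^n)$, where $x$ and $y$ are indeterminates, with maximal ideal $\mathfrak{m}$. Let $\pi$ denote the period eventually exhibited by $\phi_{\mathfrak{m},R}$, and let $\omega$ denote the order of $p+n\mathbb{Z}$ in the multiplicative group of units of $\mathbb{Z}/n\mathbb{Z}$. Then the following statements hold: (1) Let $e$ be a nonnegative integer, and let $b$ be an integer satisfying $p^e\equiv b \pmod n$ and $1\leqslant b\leqslant n-1$. Then $HK_{\mathfrak{m},R}(e)=np^e-b(n-b)$. (2) $\phi_{\mathfrak{m},R}$ is immediately periodic with $\pi\in\{\omega/2,\omega\}$. (3) $\pi=\omega/2$ if and only if $\omega$ is even and $p^{\omega/2}\equiv -1 \pmod n$.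
   Context: Let $(R,\mathfrak{m})$ be a one-dimensional commutative Noetherian local ring of prime characteristic $p$. For a nonnegative integer $e$, let $\mathfrak{m}^{[p^e]}$ denote the ideal $(r^{p^e} : r\in\mathfrak{m})$ of $R$. The Hilbert--Kunz function $HK_{\mathfrak{m},R}$ sends every nonnegative integer $e$ to the length of $R/\mathfrak{m}^{[p^e]}$ over $R$. By a theorem of Monsky, there exist a positive integer $\operatorname{e}_{HK}(\mathfrak{m},R)$ (the Hilbert--Kunz multiplicity of $R$) and an eventually periodic integer-valued function $\phi_{\mathfrak{m},R}$ on the nonnegative integers such that $HK_{\mathfrak{m},R}(e)=\operatorname{e}_{HK}(\mathfrak{m},R)\cdot p^e-\phi_{\mathfrak{m},R}(e)$ for every nonnegative integer $e$; these are uniquely determined, and this defines $\phi_{\mathfrak{m},R}$. The period eventually exhibited by an eventually periodic function $\phi$ on the nonnegative integers is the least positive integer $\pi$ such that $\phi(e+\pi)=\phi(e)$ for all sufficiently large integers $e$; $\phi$ is immediately periodic (with period $\pi$) if moreover $\phi(e+\pi)=\phi(e)$ for all integers $e\geqslant 0$. *)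

theory Defs
  imports
    "HOL-Algebra.Algebraic_Closure_Type"
    "HOL-Algebra.Multiplicative_Group"
    "HOL-Number_Theory.Residues"
    "HOL-Library.Extended_Nat"
    "HOL-Computational_Algebra.Formal_Power_Series"
begin

definition module_length ::
  "('a, 'c) ring_scheme \<Rightarrow> ('a, 'b, 'd) module_scheme \<Rightarrow> enat" where
  "module_length R M =
     Sup {enat l | l. \<exists>N :: nat \<Rightarrow> 'b set.
            (\<forall>i\<le>l. submodule (N i) R M) \<and> (\<forall>i<l. N i \<subset> N (Suc i))}"

(* The multiplicative fields of a module record are not used by the locale module;
   they are taken over from the quotient ring. *)
definition quotient_module :: "('a, 'c) ring_scheme \<Rightarrow> 'a set \<Rightarrow> ('a, 'a set) module" where
  "quotient_module R I =
     \<lparr>carrier = carrier (R Quot I), monoid.mult = monoid.mult (R Quot I),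
      one = \<one>\<^bsub>R Quot I\<^esub>, ring.zero = \<zero>\<^bsub>R Quot I\<^esub>, add = ring.add (R Quot I),
      module.smult = (\<lambda>r u. (I +>\<^bsub>R\<^esub> r) \<otimes>\<^bsub>R Quot I\<^esub> u)\<rparr>"

definition frobenius_power :: "('a, 'c) ring_scheme \<Rightarrow> 'a set \<Rightarrow> nat \<Rightarrow> 'a set" where
  "frobenius_power R I q = Idl\<^bsub>R\<^esub> {r [^]\<^bsub>R\<^esub> q | r. r \<in> I}"

definition hilbert_kunz :: "('a, 'c) ring_scheme \<Rightarrow> 'a set \<Rightarrow> nat \<Rightarrow> nat \<Rightarrow> enat" where
  "hilbert_kunz R I p e = module_length R (quotient_module R (frobenius_power R I (p ^ e)))"

definition eventual_shift :: "(nat \<Rightarrow> 'b) \<Rightarrow> nat \<Rightarrow> bool" where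
  "eventual_shift \<phi> d \<longleftrightarrow> d > 0 \<and> (\<exists>N. \<forall>e\<ge>N. \<phi> (e + d) = \<phi> e)"

definition eventually_periodic :: "(nat \<Rightarrow> 'b) \<Rightarrow> bool" where
  "eventually_periodic \<phi> \<longleftrightarrow> (\<exists>d. eventual_shift \<phi> d)"

definition eventual_period :: "(nat \<Rightarrow> 'b) \<Rightarrow> nat" where
  "eventual_period \<phi> = (LEAST d. eventual_shift \<phi> d)"

definition immediately_periodic :: "(nat \<Rightarrow> 'b) \<Rightarrow> bool" where
  "immediately_periodic \<phi> \<longleftrightarrow>
     eventually_periodic \<phi> \<and> (\<forall>e. \<phi> (e + eventual_period \<phi>) = \<phi> e)"

definition hk_decomposition ::
  "('a, 'c) ring_scheme \<Rightarrow> 'a set \<Rightarrow> nat \<Rightarrow> nat \<Rightarrow> (nat \<Rightarrow> int) \<Rightarrow> bool" where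
  "hk_decomposition R I p c \<phi> \<longleftrightarrow>
     c > 0 \<and> eventually_periodic \<phi> \<and>
     (\<forall>e. \<exists>l. hilbert_kunz R I p e = enat l \<and> int l = int c * int p ^ e - \<phi> e)"

(* Meaningful only when a decomposition exists (Monsky: I the maximal ideal of a
   one-dimensional Noetherian local ring of characteristic p); it is then unique
   by the lemma hk_decomposition_unique below. *)
definition hk_phi :: "('a, 'c) ring_scheme \<Rightarrow> 'a set \<Rightarrow> nat \<Rightarrow> nat \<Rightarrow> int" where
  "hk_phi R I p = (THE \<phi>. \<exists>c. hk_decomposition R I p c \<phi>)"

(* k[[x,y]] is rendered as k[[x]][[y]], so x is fps_const fps_X and y is the outer fps_X. *)
definition power_series_quotient :: "nat \<Rightarrow> ('k::field fps fps set) ring" where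
  "power_series_quotient n =
     ring_of_type_algebra Quot
       (Idl\<^bsub>ring_of_type_algebra\<^esub> {fps_const fps_X ^ n - fps_X ^ n})"

definition unit_order_mod :: "nat \<Rightarrow> nat \<Rightarrow> nat" where
  "unit_order_mod n a =
     group.ord (units_of (residue_ring (int n))) (int a mod int n)"

lemma module_quotient_module:
  assumes "cring R" "ideal I R"
  shows "module R (quotient_module R I)"
proof -
  interpret ideal I R by fact
  interpret R: cring R by fact
  interpret Q: cring "R Quot I" by (rule quotient_is_cring) fact
  interpret h: ring_hom_ring R "R Quot I" "(+>\<^bsub>R\<^esub>) I" by (rule rcos_ring_hom_ring)
  have *: "\<And>r. r \<in> carrier R \<Longrightarrow> I +>\<^bsub>R\<^esub> r \<in> carrier (R Quot I)"
    by (rule h.hom_closed)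
  have ab: "abelian_group (quotient_module R I)"
  proof (rule abelian_groupI)
    show "x \<oplus>\<^bsub>quotient_module R I\<^esub> y = y \<oplus>\<^bsub>quotient_module R I\<^esub> x"
      if "x \<in> carrier (quotient_module R I)" "y \<in> carrier (quotient_module R I)" for x y
      using that Q.a_comm[of x y] by (simp add: quotient_module_def)
  qed (auto simp: quotient_module_def Q.a_assoc intro: Q.l_neg)
  show ?thesis
    by (rule moduleI[OF assms(1) ab])
       (simp_all add: quotient_module_def * h.hom_add h.hom_mult Q.m_assoc Q.l_distr Q.r_distr)
qed

lemma eventually_periodic_bounded:
  fixes \<phi> :: "nat \<Rightarrow> int"
  assumes "eventually_periodic \<phi>"
  shows "\<exists>B. \<forall>e. \<bar>\<phi> e\<bar> \<le> B"
proof -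
  obtain d N where d: "d > 0" and N: "\<And>e. e \<ge> N \<Longrightarrow> \<phi> (e + d) = \<phi> e"
    using assms by (auto simp: eventually_periodic_def eventual_shift_def)
  have mem: "\<phi> e \<in> \<phi> ` {..<N + d}" for e
  proof (induction e rule: less_induct)
    case (less e)
    show ?case
    proof (cases "e < N + d")
      case False
      then have "\<phi> e = \<phi> (e - d)" using N[of "e - d"] by simp
      then show ?thesis using less[of "e - d"] d False by simp
    qed auto
  qed
  have "\<bar>\<phi> e\<bar> \<le> Max (abs ` \<phi> ` {..<N + d})" for e
    using mem[of e] by (intro Max_ge) auto
  then show ?thesis by blast
qed

lemma hk_decomposition_unique:
  assumes "p > 1" and 1: "hk_decomposition R I p c \<phi>" and 2: "hk_decomposition R I p c' \<phi>'"
  shows "c = c'" "\<phi> = \<phi>'"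
proof -
  have eq: "(int c - int c') * int p ^ e = \<phi> e - \<phi>' e" for e
  proof -
    obtain l l' where "hilbert_kunz R I p e = enat l" "int l = int c * int p ^ e - \<phi> e"
      "hilbert_kunz R I p e = enat l'" "int l' = int c' * int p ^ e - \<phi>' e"
      using 1 2 unfolding hk_decomposition_def by blast
    then show ?thesis by (simp add: left_diff_distrib)
  qed
  have per: "eventually_periodic \<phi>" "eventually_periodic \<phi>'"
    using 1 2 by (auto simp: hk_decomposition_def)
  obtain B where B: "\<And>e. \<bar>\<phi> e\<bar> \<le> B"
    using eventually_periodic_bounded[OF per(1)] by blast
  obtain B' where B': "\<And>e. \<bar>\<phi>' e\<bar> \<le> B'"
    using eventually_periodic_bounded[OF per(2)] by blast
  show "c = c'"
  proof (rule ccontr)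
    assume "c \<noteq> c'"
    then have *: "int p ^ e \<le> \<bar>int c - int c'\<bar> * int p ^ e" for e
      using \<open>p > 1\<close> by (simp add: mult_le_cancel_right1)
    have "int p ^ e \<le> B + B'" for e
    proof -
      have "\<bar>int c - int c'\<bar> * int p ^ e = \<bar>\<phi> e - \<phi>' e\<bar>"
        using arg_cong[OF eq[of e], of abs] by (simp add: abs_mult)
      then show ?thesis using *[of e] B[of e] B'[of e] by linarith
    qed
    moreover have "int e < int p ^ e" for e
      using power_gt_expt[of p e] \<open>p > 1\<close> by (simp flip: of_nat_power)
    ultimately have "int (nat (B + B')) < B + B'"
      by (rule less_le_trans[rotated])
    then show False by linarith
  qed
  then show "\<phi> = \<phi>'" using eq by auto
qed

end

theory Submission
  imports Defs
begin

text \<open>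
  Put \<open>q = p ^ e\<close>, write \<open>b\<close> for its remainder modulo \<open>n\<close> and \<open>M = q - b\<close>. Since the \<open>q\<close>-th power map is
  additive, the length in question is that of \<open>k[[x,y]] / J\<close> with \<open>J = (x^n - y^n, x^q, y^q)\<close>. As
  \<open>x^M y^b\<close> is congruent to \<open>y^q\<close>, the quotient is spanned over \<open>k\<close> by the \<open>M n + b^2 = n q - b (n - b)\<close>
  monomials \<open>x^i y^j\<close> with \<open>j < n\<close>, \<open>i < q\<close> and \<open>j < b\<close> or \<open>i < M\<close>, which bounds the length from above.
  For the lower bound, the functional \<open>f \<mapsto> \<Sum>t. [x^(i - n t) y^(j + n t)] f\<close> vanishes on \<open>J\<close> for each
  such pair \<open>(i, j)\<close>. Starting with the largest ideal killed by all of these functionals and dropping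
  the pairs one at a time, those of largest total degree first, the ideal grows strictly at every step.

  The function \<open>\<phi>\<close> therefore has value \<open>b (n - b)\<close> at \<open>e\<close>, which determines \<open>p ^ e\<close> modulo \<open>n\<close> up to
  sign, so its period is the least \<open>d > 0\<close> with \<open>p ^ d \<equiv> \<plusminus>1\<close> modulo \<open>n\<close>.
\<close>

subsection \<open>Lengths of quotients and chains of ideals\<close>

text \<open>Only the values at \<open>0\<close>, ..., \<open>l\<close> matter, and \<open>l\<close>
  counts strict inclusions. The chain need not start at \<open>I\<close> or end at the whole ring,
  since only the supremum of the lengths is taken.\<close>

definition ideal_chain :: "('a, 'c) ring_scheme \<Rightarrow> 'a set \<Rightarrow> nat \<Rightarrow> (nat \<Rightarrow> 'a set) \<Rightarrow> bool" where
  "ideal_chain R I l N \<longleftrightarrow>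
     (\<forall>i\<le>l. ideal (N i) R \<and> I \<subseteq> N i) \<and> (\<forall>i<l. N i \<subset> N (Suc i))"

text \<open>A scalar acts through its coset, and every element of the quotient ring is a coset, so
  closure under scalars and closure under multiplication are the same condition.\<close>

lemma submodule_quotient_module_iff:
  assumes "cring R" "ideal I R"
  shows "submodule N R (quotient_module R I) \<longleftrightarrow> ideal N (R Quot I)"
proof -
  interpret ideal I R by fact
  interpret R: cring R by fact
  interpret Q: cring "R Quot I" by (rule quotient_is_cring) fact
  have add: "subgroup N (add_monoid (quotient_module R I)) \<longleftrightarrow> subgroup N (add_monoid (R Quot I))"
    by (simp add: quotient_module_def subgroup_def m_inv_def)
  have carr: "carrier (R Quot I) = (+>\<^bsub>R\<^esub>) I ` carrier R"
    by (auto simp: FactRing_def A_RCOSETS_def')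
  show ?thesis
  proof
    assume N: "submodule N R (quotient_module R I)"
    then have sg: "subgroup N (add_monoid (R Quot I))"
      using add by (simp add: submodule_def)
    then have sub: "N \<subseteq> carrier (R Quot I)"
      using subgroup.subset by fastforce
    have cl: "x \<otimes>\<^bsub>R Quot I\<^esub> a \<in> N" if "a \<in> N" "x \<in> carrier (R Quot I)" for a x
      using submodule.smult_closed[OF N] that by (auto simp: carr quotient_module_def)
    show "ideal N (R Quot I)"
    proof (rule idealI[OF Q.ring_axioms sg cl])
      show "a \<otimes>\<^bsub>R Quot I\<^esub> x \<in> N" if "a \<in> N" "x \<in> carrier (R Quot I)" for a x
        using cl[OF that] Q.m_comm[of a x] that sub by auto
    qed
  next
    assume N: "ideal N (R Quot I)"
    interpret N: ideal N "R Quot I" by fact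
    show "submodule N R (quotient_module R I)"
      unfolding submodule_def submodule_axioms_def add
      using N.a_subgroup N.I_l_closed by (auto simp: quotient_module_def carr)
  qed
qed

text \<open>Taking images and taking unions are mutually inverse, inclusion-preserving maps between
  ideals above \<open>I\<close> and ideals of the quotient. A general \<open>K\<close> allows two
  uses: the zero ideal \<open>{I}\<close>, and a Frobenius power in a quotient ring.\<close>

lemma ex_ideal_chain_quotient_iff:
  assumes I: "ideal I R" and K: "ideal K (R Quot I)"
  shows "(\<exists>N. ideal_chain (R Quot I) K l N) \<longleftrightarrow> (\<exists>N. ideal_chain R (\<Union>K) l N)"
proof -
  interpret ideal I R by fact
  let ?f = "\<lambda>J. (+>\<^bsub>R\<^esub>) I ` J"
  have bij: "bij_betw ?f {J. ideal J R \<and> I \<subseteq> J} {J. ideal J (R Quot I)}"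
    by (rule quot_ideal_correspondence) fact
  have up: "\<Union>(?f J) = J" if "ideal J R" "I \<subseteq> J" for J
    using ideal_incl_iff[OF I that(1)] that(2) by blast
  have down: "?f (\<Union>J) = J \<and> ideal (\<Union>J) R \<and> I \<subseteq> \<Union>J" if "ideal J (R Quot I)" for J
  proof -
    have "J \<in> ?f ` {J. ideal J R \<and> I \<subseteq> J}"
      using bij that by (simp add: bij_betw_def)
    then obtain J0 where "ideal J0 R" "I \<subseteq> J0" "J = ?f J0"
      by blast
    then show ?thesis using up by simp
  qed
  have IK: "I \<subseteq> \<Union>K" using down[OF K] by blast
  show ?thesis
  proof
    assume "\<exists>N. ideal_chain (R Quot I) K l N"
    then obtain N where N: "\<And>i. i \<le> l \<Longrightarrow> ideal (N i) (R Quot I) \<and> K \<subseteq> N i"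
      "\<And>i. i < l \<Longrightarrow> N i \<subset> N (Suc i)"
      by (auto simp: ideal_chain_def)
    have "ideal_chain R (\<Union>K) l (\<lambda>i. \<Union>(N i))"
      unfolding ideal_chain_def
    proof (intro conjI allI impI)
      fix i assume i: "i < l"
      have "?f (\<Union>(N i)) \<noteq> ?f (\<Union>(N (Suc i)))"
        using down N(1)[of i] N(1)[of "Suc i"] N(2)[OF i] i by auto
      then show "\<Union>(N i) \<subset> \<Union>(N (Suc i))" using N(2)[OF i] by blast
    qed (use N(1) down in auto)
    then show "\<exists>N. ideal_chain R (\<Union>K) l N" by blast
  next
    assume "\<exists>N. ideal_chain R (\<Union>K) l N"
    then obtain N where N: "\<And>i. i \<le> l \<Longrightarrow> ideal (N i) R \<and> \<Union>K \<subseteq> N i"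
      "\<And>i. i < l \<Longrightarrow> N i \<subset> N (Suc i)"
      by (auto simp: ideal_chain_def)
    have IN: "ideal (N i) R" "I \<subseteq> N i" if "i \<le> l" for i
      using N(1)[OF that] IK by auto
    have "ideal_chain (R Quot I) K l (\<lambda>i. ?f (N i))"
      unfolding ideal_chain_def
    proof (intro conjI allI impI)
      fix i assume i: "i \<le> l"
      show "ideal (?f (N i)) (R Quot I)"
        by (rule ring_ideal_imp_quot_ideal[OF I]) (use IN i in auto)
      have "?f (\<Union>K) \<subseteq> ?f (N i)" using N(1)[OF i] by blast
      then show "K \<subseteq> ?f (N i)" using down[OF K] by simp
    next
      fix i assume i: "i < l"
      have "\<Union>(?f (N i)) = N i" "\<Union>(?f (N (Suc i))) = N (Suc i)"
        using i by (intro up IN; simp)+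
      then have "?f (N i) \<noteq> ?f (N (Suc i))" using N(2)[OF i] by (metis psubset_eq)
      then show "?f (N i) \<subset> ?f (N (Suc i))" using N(2)[OF i] by blast
    qed
    then show "\<exists>N. ideal_chain (R Quot I) K l N" by blast
  qed
qed

lemma module_length_quotient_module:
  assumes "cring R" "ideal I R"
  shows "module_length R (quotient_module R I) = Sup {enat l | l. \<exists>N. ideal_chain R I l N}"
proof -
  interpret ideal I R by fact
  interpret Q: ring "R Quot I" by (rule quotient_is_ring)
  have zero: "ideal {I} (R Quot I)" "\<zero>\<^bsub>R Quot I\<^esub> = I"
    using Q.zeroideal by (auto simp: FactRing_def)
  \<comment> \<open>Every ideal of the quotient contains its zero \<open>I\<close>, so the lower
    bound \<open>{I}\<close> costs nothing.\<close>
  have "(\<forall>i\<le>l. submodule (N i) R (quotient_module R I)) \<and> (\<forall>i<l. N i \<subset> N (Suc i)) \<longleftrightarrow>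
        ideal_chain (R Quot I) {I} l N" for l and N :: "nat \<Rightarrow> 'a set set"
    using additive_subgroup.zero_closed[OF ideal.axioms(1), of _ "R Quot I"] zero(2)
    by (auto simp: ideal_chain_def submodule_quotient_module_iff[OF assms])
  then have "(\<exists>N. (\<forall>i\<le>l. submodule (N i) R (quotient_module R I)) \<and> (\<forall>i<l. N i \<subset> N (Suc i))) \<longleftrightarrow>
        (\<exists>N. ideal_chain R I l N)" for l
    using ex_ideal_chain_quotient_iff[OF assms(2) zero(1)] by simp
  then show ?thesis unfolding module_length_def by simp
qed

text \<open>Moves the length computation from the quotient ring into \<open>A\<close> itself, where
  it is carried out below.\<close>

lemma module_length_quotient_of_quotient:
  assumes "cring A" "ideal P A" "ideal I (A Quot P)"
  shows "module_length (A Quot P) (quotient_module (A Quot P) I) =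
           Sup {enat l | l. \<exists>N. ideal_chain A (\<Union>I) l N}"
  using ideal.quotient_is_cring[OF assms(2,1)] assms
  by (simp add: module_length_quotient_module ex_ideal_chain_quotient_iff)

text \<open>Closure under negation comes from multiplication by \<open>-1\<close>.\<close>

lemma ideal_type_algebra_iff:
  "ideal (K :: 'a :: comm_ring_1 set) ring_of_type_algebra \<longleftrightarrow>
     0 \<in> K \<and> (\<forall>x\<in>K. \<forall>y\<in>K. x + y \<in> K) \<and> (\<forall>r. \<forall>x\<in>K. r * x \<in> K)"
  (is "_ \<longleftrightarrow> ?rhs")
proof
  interpret A: cring "ring_of_type_algebra :: 'a ring" by rule
  {
    assume "ideal K ring_of_type_algebra"
    then interpret ideal K "ring_of_type_algebra :: 'a ring" .
    show ?rhs
      using zero_closed a_closed I_l_closed by (simp add: ring_of_type_algebra_def)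
  next
    assume K: ?rhs
    have neg: "- x \<in> K" if "x \<in> K" for x
      using K that by (metis mult_minus1)
    have K': "x * r \<in> K" if "x \<in> K" for x r
      using K that by (metis mult.commute)
    have inv: "inv\<^bsub>add_monoid ring_of_type_algebra\<^esub> x = - x" for x :: 'a
      using A.minus_equality[of "- x" x]
      by (simp add: a_inv_def ring_of_type_algebra_def)
    show "ideal K ring_of_type_algebra"
    proof (rule idealI)
      show "subgroup K (add_monoid ring_of_type_algebra)"
        by unfold_locales (use K neg inv in \<open>auto simp: ring_of_type_algebra_def\<close>)
    qed (use K K' A.ring_axioms in \<open>simp_all add: ring_of_type_algebra_def\<close>)
  }
qed

lemma
  assumes "ideal (K :: 'a :: comm_ring_1 set) ring_of_type_algebra"
  shows ideal_type_algebra_add: "x \<in> K \<Longrightarrow> y \<in> K \<Longrightarrow> x + y \<in> K"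
    and ideal_type_algebra_mult: "x \<in> K \<Longrightarrow> r * x \<in> K"
  using assms by (simp_all add: ideal_type_algebra_iff)

subsection \<open>Powers of \<open>p\<close> modulo \<open>n\<close>\<close>

text \<open>With \<open>a\<close> and \<open>b\<close> the two remainders, a(n - a) - b(n - b) = (a
  - b)(n - a - b).\<close>

lemma mod_times_complement_eq_iff:
  fixes x y n :: int
  assumes "n > 0"
  shows "x mod n * (n - x mod n) = y mod n * (n - y mod n) \<longleftrightarrow>
           [x = y] (mod n) \<or> [x = - y] (mod n)"
proof -
  define a b where "a = x mod n" and "b = y mod n"
  have ab: "0 \<le> a" "a < n" "0 \<le> b" "b < n" using assms by (auto simp: a_def b_def)
  have "a * (n - a) = b * (n - b) \<longleftrightarrow> (a - b) * (n - a - b) = 0"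
    by (auto simp: algebra_simps)
  also have "\<dots> \<longleftrightarrow> a = b \<or> a + b = n"
    by auto
  also have "\<dots> \<longleftrightarrow> a = b \<or> n dvd a + b"
  proof -
    \<comment> \<open>As 0 \<le> a + b < 2n, divisibility leaves a + b = n or a = b = 0.\<close>
    have "a = b \<or> a + b = n" if d: "n dvd a + b"
    proof -
      obtain k where k: "a + b = n * k" using d by blast
      have "n * k < n * 2" "n * (-1) < n * k" using ab k by linarith+
      then have "k < 2" "- 1 < k" using assms by (simp_all only: mult_less_cancel_left_pos)
      then have "k = 0 \<or> k = 1" by linarith
      then show ?thesis using k ab by auto
    qed
    then show ?thesis by auto
  qed
  also have "n dvd a + b \<longleftrightarrow> [x = - y] (mod n)"
    by (simp add: a_def b_def cong_iff_dvd_diff mod_simps dvd_eq_mod_eq_0)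
  finally show ?thesis by (simp add: a_def b_def cong_def)
qed

lemma unit_order_mod_dvd_iff:
  assumes "n > 1" "coprime p n"
  shows "unit_order_mod n p dvd d \<longleftrightarrow> [int p ^ d = 1] (mod int n)"
proof -
  interpret residues "int n" "residue_ring (int n)"
    by unfold_locales (use assms in auto)
  let ?R = "residue_ring (int n)"
  let ?U = "units_of ?R"
  interpret U: group ?U by (rule units_group)
  have mem: "int p mod int n \<in> carrier ?U"
    using assms by (simp add: units_of_carrier)
  have "unit_order_mod n p dvd d \<longleftrightarrow> (int p mod int n) [^]\<^bsub>?U\<^esub> d = \<one>\<^bsub>?U\<^esub>"
    unfolding unit_order_mod_def by (rule U.pow_eq_id[OF mem, symmetric])
  also have "(int p mod int n) [^]\<^bsub>?U\<^esub> d = (int p mod int n) [^]\<^bsub>?R\<^esub> d"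
    using mem by (simp add: units_of_pow units_of_carrier)
  also have "\<dots> = int p ^ d mod int n"
    by (rule pow_cong)
  also have "\<one>\<^bsub>?U\<^esub> = 1 mod int n"
    by (simp add: units_of_one one_cong)
  finally show ?thesis by (simp add: cong_def)
qed

lemma unit_order_mod_pos:
  assumes "n > 1" "coprime p n"
  shows "unit_order_mod n p > 0"
proof -
  have "[p ^ totient n = 1] (mod n)"
    by (rule euler_theorem) (use assms in \<open>simp add: coprime_commute\<close>)
  then have "[int p ^ totient n = 1] (mod int n)"
    by (metis cong_int_iff of_nat_1 of_nat_power)
  moreover have "totient n > 0" using assms by simp
  ultimately show ?thesis using unit_order_mod_dvd_iff[OF assms] by (metis dvd_0_left_iff gr0I)
qed

text \<open>Whether \<open>d\<close> is a shift does not depend on \<open>e\<close>, so a shift that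
  works for large \<open>e\<close> works from the start.\<close>

lemma eventual_period_shift_invariant:
  assumes "\<And>e d. \<phi> (e + d) = \<phi> e \<longleftrightarrow> Q d" and "Q d0" "d0 > 0"
  shows "eventual_period \<phi> = (LEAST d. d > 0 \<and> Q d)" "immediately_periodic \<phi>"
proof -
  have s: "eventual_shift \<phi> d \<longleftrightarrow> d > 0 \<and> Q d" for d
    using assms(1) by (auto simp: eventual_shift_def)
  then show *: "eventual_period \<phi> = (LEAST d. d > 0 \<and> Q d)"
    by (simp add: eventual_period_def)
  have "Q (eventual_period \<phi>)"
    unfolding * using LeastI[of "\<lambda>d. d > 0 \<and> Q d" d0] assms by auto
  then show "immediately_periodic \<phi>"
    using s assms by (auto simp: immediately_periodic_def eventually_periodic_def)
qed

text \<open>Squaring shows that \<open>\<omega>\<close> divides \<open>2 * \<pi>\<close>, and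
  \<open>\<omega>\<close> is itself a candidate for the minimum, so \<open>2 * \<pi>\<close> is
  \<open>\<omega>\<close> or \<open>2 * \<omega>\<close>.\<close>

lemma least_exponent_plus_minus_one:
  fixes n p :: nat
  assumes n: "n > 1" and p: "coprime p n"
  defines "\<omega> \<equiv> unit_order_mod n p"
    and "\<pi> \<equiv> LEAST d. d > 0 \<and> ([int p ^ d = 1] (mod int n) \<or> [int p ^ d = - 1] (mod int n))"
  shows "real \<pi> \<in> {real \<omega> / 2, real \<omega>}"
    and "real \<pi> = real \<omega> / 2 \<longleftrightarrow> even \<omega> \<and> [int p ^ (\<omega> div 2) = - 1] (mod int n)"
proof -
  define Q where "Q d \<longleftrightarrow> [int p ^ d = 1] (mod int n) \<or> [int p ^ d = - 1] (mod int n)" for d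
  have \<pi>: "\<pi> = (LEAST d. d > 0 \<and> Q d)" by (simp add: \<pi>_def Q_def)
  have dvd: "\<omega> dvd d \<longleftrightarrow> [int p ^ d = 1] (mod int n)" for d
    unfolding \<omega>_def by (rule unit_order_mod_dvd_iff[OF n p])
  have pos: "\<omega> > 0" unfolding \<omega>_def by (rule unit_order_mod_pos[OF n p])
  have Q\<omega>: "\<omega> > 0 \<and> Q \<omega>" using pos dvd[of \<omega>] by (simp add: Q_def)
  have Q\<pi>: "\<pi> > 0 \<and> Q \<pi>" unfolding \<pi> by (rule LeastI) (rule Q\<omega>)
  have min: "\<pi> \<le> d" if "d > 0" "Q d" for d
    unfolding \<pi> by (rule Least_le) (use that in simp)
  have "[int p ^ \<pi> * int p ^ \<pi> = 1] (mod int n)"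
    using Q\<pi> cong_mult[of "int p ^ \<pi>" 1 _ "int p ^ \<pi>" 1]
      cong_mult[of "int p ^ \<pi>" "-1" _ "int p ^ \<pi>" "-1"] by (auto simp: Q_def)
  then have "\<omega> dvd 2 * \<pi>" by (simp add: dvd mult_2 power_add)
  then obtain k where k: "2 * \<pi> = \<omega> * k" by blast
  have le: "\<pi> \<le> \<omega>" using min Q\<omega> by blast
  have "\<omega> * k \<le> \<omega> * 2" using k le by linarith
  then have "k \<le> 2" using pos by simp
  moreover have "k \<noteq> 0"
    using k Q\<pi> by (metis mult_0_right nat_mult_eq_cancel_disj not_gr_zero zero_neq_numeral)
  ultimately have "k = 1 \<or> k = 2" by linarith
  then have cases: "2 * \<pi> = \<omega> \<or> \<pi> = \<omega>" using k by auto
  then show "real \<pi> \<in> {real \<omega> / 2, real \<omega>}" by auto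
  have half: "real \<pi> = real \<omega> / 2 \<longleftrightarrow> 2 * \<pi> = \<omega>" by auto
  show "real \<pi> = real \<omega> / 2 \<longleftrightarrow> even \<omega> \<and> [int p ^ (\<omega> div 2) = - 1] (mod int n)"
    unfolding half
  proof
    assume eq: "2 * \<pi> = \<omega>"
    \<comment> \<open>Below the order the power cannot be 1, so it must be -1.\<close>
    have "\<not> \<omega> dvd \<pi>" using eq Q\<pi> by (auto dest: dvd_imp_le)
    then have "[int p ^ \<pi> = - 1] (mod int n)" using Q\<pi> dvd by (auto simp: Q_def)
    then show "even \<omega> \<and> [int p ^ (\<omega> div 2) = - 1] (mod int n)" using eq by auto
  next
    assume *: "even \<omega> \<and> [int p ^ (\<omega> div 2) = - 1] (mod int n)"
    \<comment> \<open>Now \<open>\<omega> div 2\<close> is a candidate, which rules out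
      \<open>\<pi> = \<omega>\<close>.\<close>
    then have "\<pi> \<le> \<omega> div 2" using pos by (intro min) (auto simp: Q_def elim!: evenE)
    then show "2 * \<pi> = \<omega>" using cases pos by linarith
  qed
qed

subsection \<open>The quotient of the power series ring\<close>

abbreviation xx :: "'a::comm_ring_1 fps fps" where "xx \<equiv> fps_const fps_X"

abbreviation yy :: "'a::comm_ring_1 fps fps" where "yy \<equiv> fps_X"

text \<open>As a simp rule this would merge \<open>xx ^ i\<close> into a single constant \<open>fps_const (fps_X ^ i)\<close>.\<close>
declare fps_const_power [simp del]

section \<open>Diagonal coefficient functionals\<close>

lemma monomial_mult_nth:
  "(xx ^ a * yy ^ c * g) $ j $ i = (if a \<le> i \<and> c \<le> j then g $ (j - c) $ (i - a) else 0)"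
  by (auto simp: fps_X_power_mult_nth fps_const_power mult.assoc)

text \<open>The coefficient at \<open>x ^ i * y ^ j\<close> once \<open>y ^ n\<close> has been replaced by \<open>x ^ n\<close> throughout.\<close>
definition diag_coeff :: "nat \<Rightarrow> nat \<Rightarrow> nat \<Rightarrow> 'a::comm_ring_1 fps fps \<Rightarrow> 'a" where
  "diag_coeff n i j f = (\<Sum>t | n * t \<le> i. f $ (j + n * t) $ (i - n * t))"

lemma diag_coeff_0 [simp]: "diag_coeff n i j 0 = 0"
  by (simp add: diag_coeff_def)

lemma diag_coeff_add: "diag_coeff n i j (f + g) = diag_coeff n i j f + diag_coeff n i j g"
  by (simp add: diag_coeff_def sum.distrib)

lemma diag_coeff_diff: "diag_coeff n i j (f - g) = diag_coeff n i j f - diag_coeff n i j g"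
  by (simp add: diag_coeff_def sum_subtractf)

lemma diag_coeff_monomial_mult:
  "diag_coeff n i j (xx ^ a * yy ^ c * g) =
     (\<Sum>t | n * t \<le> i. if a \<le> i - n * t \<and> c \<le> j + n * t
        then g $ (j + n * t - c) $ (i - n * t - a) else 0)"
  by (simp add: diag_coeff_def monomial_mult_nth)

lemma finite_multiples_le:
  fixes n :: nat
  assumes "n > 0"
  shows "finite {t. n * t \<le> i}"
proof (rule finite_subset)
  have "t \<le> n * t" for t using assms by simp
  then show "{t. n * t \<le> i} \<subseteq> {..i}" using le_trans by blast
qed simp

text \<open>Both sides sum the same coefficients of \<open>f\<close>, with \<open>t\<close> shifted
  by one. The extra term \<open>t = 0\<close> on the right vanishes because
  \<open>j < n\<close>.\<close>

lemma diag_coeff_shift: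
  assumes "j < n"
  shows "diag_coeff n i j (xx ^ n * f) = diag_coeff n i j (yy ^ n * f)"
proof -
  have n: "n > 0" using assms by simp
  have fin: "finite {t. n * t \<le> i}" by (rule finite_multiples_le[OF n])
  have n_le: "n \<le> j + n * t" if "t > 0" for t
    using that by (cases t) auto
  have "diag_coeff n i j (xx ^ n * yy ^ 0 * f) =
      (\<Sum>t | n * Suc t \<le> i. f $ (j + n * t) $ (i - n * Suc t))"
    unfolding diag_coeff_monomial_mult
    by (rule sum.mono_neutral_cong_right[OF fin]) (auto simp: add.commute)
  also have "\<dots> = (\<Sum>t | n * t \<le> i \<and> t \<noteq> 0. f $ (j + n * t - n) $ (i - n * t))"
    by (rule sum.reindex_bij_witness[where i = "\<lambda>t. t - 1" and j = Suc]) (auto simp: gr0_conv_Suc)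
  also have "\<dots> = diag_coeff n i j (xx ^ 0 * yy ^ n * f)"
    unfolding diag_coeff_monomial_mult
    by (rule sum.mono_neutral_cong_left[OF fin]) (use assms in \<open>auto intro!: gr0I simp: n_le\<close>)
  finally show ?thesis by simp
qed

text \<open>Here \<open>M + b\<close> stands for \<open>p ^ e\<close>, with remainder \<open>b\<close> modulo \<open>n\<close>. The parameter \<open>K\<close> only
  fixes the coefficient field.\<close>
locale diagonal_truncation =
  fixes n M b :: nat and K :: "'k::field itself"
  assumes dvd: "n dvd M" and b: "0 < b" "b < n"
begin

lemma n_pos: "n > 0" using b by simp

definition exponents :: "(nat \<times> nat) set" where
  "exponents = {(i, j). j < n \<and> i < M + b \<and> (j < b \<or> i < M)}"

text \<open>Explicit combinations of the three generators, so that membership yields the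
  coefficients \<open>u\<close>, \<open>v\<close>, \<open>w\<close> directly.\<close>

definition J :: "'k fps fps set" where
  "J = {u * (xx ^ n - yy ^ n) + v * xx ^ (M + b) + w * yy ^ (M + b) | u v w. True}"

lemma JI: "f = u * (xx ^ n - yy ^ n) + v * xx ^ (M + b) + w * yy ^ (M + b) \<Longrightarrow> f \<in> J"
  unfolding J_def by blast

lemma J_mult: "f \<in> J \<Longrightarrow> g * f \<in> J"
  unfolding J_def
  by (clarsimp simp: distrib_left mult.assoc[symmetric]) blast

lemma J_add: assumes "f \<in> J" "g \<in> J" shows "f + g \<in> J"
proof -
  obtain u v w u' v' w' where
    f: "f = u * (xx ^ n - yy ^ n) + v * xx ^ (M + b) + w * yy ^ (M + b)"
    and g: "g = u' * (xx ^ n - yy ^ n) + v' * xx ^ (M + b) + w' * yy ^ (M + b)"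
    using assms unfolding J_def by blast
  then show ?thesis
    unfolding f g
    by (intro JI[where u = "u + u'" and v = "v + v'" and w = "w + w'"]) (simp add: algebra_simps)
qed

lemma J_gens:
  "u * (xx ^ n - yy ^ n) \<in> J" "u * xx ^ (M + b) \<in> J" "u * yy ^ (M + b) \<in> J" "0 \<in> J"
  by (rule JI[where u = u and v = 0 and w = 0], simp)
     (rule JI[where u = 0 and v = u and w = 0], simp,
      rule JI[where u = 0 and v = 0 and w = u], simp,
      rule JI[where u = 0 and v = 0 and w = 0], simp)

lemma ideal_J: "ideal J ring_of_type_algebra"
  by (simp add: ideal_type_algebra_iff J_gens J_add J_mult)

section \<open>Lower bound: a strict chain cut out by the functionals\<close>

lemma finite_exponents: "finite exponents"
  by (rule finite_subset[of _ "{..<M + b} \<times> {..<n}"]) (auto simp: exponents_def)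

lemma card_exponents: "card exponents = M * n + b * b"
proof -
  have "exponents = {..<M} \<times> {..<n} \<union> {M..<M + b} \<times> {..<b}"
    using b by (auto simp: exponents_def)
  moreover have "card ({..<M} \<times> {..<n} \<union> {M..<M + b} \<times> {..<b}) = M * n + b * b"
    by (subst card_Un_disjoint) auto
  ultimately show ?thesis by simp
qed

text \<open>One generator at a time: the first by \<open>diag_coeff_shift\<close>, the second
  because all x-exponents read are at most \<open>i < M + b\<close>, the third because all
  y-exponents read stay below \<open>M + b\<close>.\<close>

lemma diag_coeff_J:
  assumes "f \<in> J" "(i, j) \<in> exponents"
  shows "diag_coeff n i j f = 0"
proof -
  obtain u v w where f: "f = u * (xx ^ n - yy ^ n) + v * xx ^ (M + b) + w * yy ^ (M + b)"
    using assms unfolding J_def by blast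
  have ij: "j < n" "i < M + b" "j < b \<or> i < M" using assms by (auto simp: exponents_def)
  have 1: "diag_coeff n i j (u * (xx ^ n - yy ^ n)) = 0"
    using diag_coeff_shift[OF ij(1), of i u]
    by (simp add: right_diff_distrib diag_coeff_diff mult.commute)
  have "diag_coeff n i j (xx ^ (M + b) * yy ^ 0 * v) = 0"
    unfolding diag_coeff_monomial_mult using ij by (intro sum.neutral) auto
  then have 2: "diag_coeff n i j (v * xx ^ (M + b)) = 0"
    by (simp add: mult.commute)
  have "diag_coeff n i j (xx ^ 0 * yy ^ (M + b) * w) = 0"
    unfolding diag_coeff_monomial_mult
  proof (intro sum.neutral ballI)
    fix t assume "t \<in> {t. n * t \<le> i}"
    then have t: "n * t \<le> i" by simp
    obtain k where k: "M = n * k" using dvd by blast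
    \<comment> \<open>Otherwise \<open>j < n\<close> forces \<open>t \<ge> k\<close>, hence
      \<open>i \<ge> M\<close> and so \<open>j < b\<close>. Then \<open>n * t > M\<close>, so
      \<open>t > k\<close> and \<open>i \<ge> n * t \<ge> M + n > M + b\<close>, a
      contradiction.\<close>
    have "j + n * t < M + b"
    proof (rule ccontr)
      assume "\<not> ?thesis"
      then have ge: "M + b \<le> j + n * t" by simp
      have "k < Suc t"
      proof (rule ccontr)
        assume "\<not> k < Suc t"
        then have "n * Suc t \<le> n * k" by (intro mult_le_mono2) simp
        then show False using ge ij k b by simp
      qed
      then have "n * k \<le> n * t" by (intro mult_le_mono2) (simp only: less_Suc_eq_le)
      then have "M \<le> i" using k t by linarith
      then have "j < b" using ij by simp
      then have "n * k < n * t" using ge k by linarith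
      then have "Suc k \<le> t" by simp
      then have "n * Suc k \<le> n * t" by (rule mult_le_mono2)
      then show False using t ij b k by simp
    qed
    then show "(if 0 \<le> i - n * t \<and> M + b \<le> j + n * t
        then w $ (j + n * t - (M + b)) $ (i - n * t - 0) else 0) = 0" by simp
  qed
  then have 3: "diag_coeff n i j (w * yy ^ (M + b)) = 0"
    by (simp add: mult.commute)
  show ?thesis unfolding f diag_coeff_add 1 2 3 by simp
qed

text \<open>The functional reads only total degree \<open>i + j\<close>, while the multiple has no
  terms of degree below \<open>a + c\<close>. In the case of equality it could only read the
  position \<open>(a, c)\<close>, and \<open>c < n\<close> forces \<open>t = 0\<close>
  there.\<close>

lemma diag_coeff_monomial_mult_eq_0:
  assumes "j < n" "c < n" "i + j \<le> a + c" "(i, j) \<noteq> (a, c)"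
  shows "diag_coeff n i j (xx ^ a * yy ^ c * g) = 0"
  unfolding diag_coeff_monomial_mult
proof (intro sum.neutral ballI)
  fix t assume "t \<in> {t. n * t \<le> i}"
  then have t: "n * t \<le> i" by simp
  have "\<not> (a \<le> i - n * t \<and> c \<le> j + n * t)"
  proof
    assume *: "a \<le> i - n * t \<and> c \<le> j + n * t"
    then have "c = j + n * t" "a = i - n * t" using assms(3) t by linarith+
    moreover from this have "t = 0" using assms(2) by (cases t) auto
    ultimately show False using assms(4) by simp
  qed
  then show "(if a \<le> i - n * t \<and> c \<le> j + n * t
        then g $ (j + n * t - c) $ (i - n * t - a) else 0) = 0" by (rule if_not_P)
qed

lemma diag_coeff_monomial_self:
  assumes "j < n"
  shows "diag_coeff n i j (xx ^ i * yy ^ j) = (1 :: 'k)"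
proof -
  have "diag_coeff n i j (xx ^ i * yy ^ j * 1) = 
    (\<Sum>t | n * t \<le> i. if t = 0 then (1 :: 'k) else 0)"
    unfolding diag_coeff_monomial_mult
    by (rule sum.cong) (use n_pos in auto)
  also have "\<dots> = 1"
    using finite_multiples_le[OF n_pos, of i] by (simp add: sum.delta)
  finally show ?thesis by simp
qed

text \<open>The largest ideal on which all the functionals indexed by \<open>T\<close> vanish.\<close>
definition diag_ideal :: "(nat \<times> nat) set \<Rightarrow> 'k fps fps set" where
  "diag_ideal T = {f. \<forall>g. \<forall>(i, j)\<in>T. diag_coeff n i j (g * f) = 0}"

lemma ideal_diag_ideal: "ideal (diag_ideal T) ring_of_type_algebra"
  unfolding ideal_type_algebra_iff diag_ideal_def
  by (auto simp: distrib_left diag_coeff_add mult.assoc[symmetric] split_beta)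

lemma J_subset_diag_ideal: "J \<subseteq> diag_ideal exponents"
  by (auto simp: diag_ideal_def intro: diag_coeff_J J_mult)

text \<open>Fixing \<open>N 0\<close> in the claim lets the induction put a smaller ideal in front
  of the chain.\<close>

lemma ideal_chain_diag_ideal:
  assumes "T \<subseteq> exponents"
  shows "\<exists>N. N 0 = diag_ideal T \<and> ideal_chain ring_of_type_algebra (diag_ideal T) (card T) N"
proof -
  have "finite T" using assms finite_exponents finite_subset by blast
  then show ?thesis using assms
  proof (induction T rule: finite_ranking_induct[where f = "\<lambda>(i, j). i + j"])
    case empty
    then show ?case
      by (intro exI[of _ "\<lambda>_. diag_ideal {}"]) (simp add: ideal_chain_def ideal_diag_ideal)
  next
    \<comment> \<open>The new pair \<open>s\<close> has the largest total degree so far; the rule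
      does not exclude \<open>s \<in> T\<close>.\<close>
    case (insert s T)
    obtain a c where s: "s = (a, c)" by fastforce
    have c: "c < n" using insert s by (auto simp: exponents_def)
    show ?case
    proof (cases "s \<in> T")
      case True
      then show ?thesis using insert by (simp add: insert_absorb)
    next
      case False
      obtain N where N: "N 0 = diag_ideal T"
        "ideal_chain ring_of_type_algebra (diag_ideal T) (card T) N"
        using insert by auto
      have "diag_coeff n i j (g * (xx ^ a * yy ^ c)) = 0" if "(i, j) \<in> T" for i j and g :: "'k fps fps"
      proof -
        have "i + j \<le> a + c" using insert(2)[OF that] s by simp
        moreover have "j < n" using that insert by (auto simp: exponents_def)
        moreover have "(i, j) \<noteq> (a, c)" using that False s by auto
        ultimately show ?thesis
          using diag_coeff_monomial_mult_eq_0[of j c i a g] c by (simp add: mult_ac)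
      qed
      \<comment> \<open>The monomial of the new pair separates the two ideals.\<close>
      then have "xx ^ a * yy ^ c \<in> diag_ideal T"
        by (auto simp: diag_ideal_def)
      moreover have "xx ^ a * yy ^ c \<notin> diag_ideal (insert s T)"
        using diag_coeff_monomial_self[OF c, of a] s
        by (auto simp: diag_ideal_def intro!: exI[of _ 1])
      moreover have "diag_ideal (insert s T) \<subseteq> diag_ideal T"
        by (auto simp: diag_ideal_def)
      ultimately have strict: "diag_ideal (insert s T) \<subset> diag_ideal T" by blast
      show ?thesis
        using N strict insert(1) False ideal_diag_ideal[of "insert s T"]
        by (intro exI[of _ "case_nat (diag_ideal (insert s T)) N"])
           (fastforce simp: ideal_chain_def less_Suc_eq_0_disj split: nat.split)
    qed
  qed
qed

section \<open>Upper bound: monomials spanning modulo \<open>J\<close>\<close>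

sublocale cf: vector_space "\<lambda>c f. fps_const (fps_const c) * f :: 'k fps fps"
  by unfold_locales
    (simp_all add: distrib_left distrib_right flip: fps_const_add fps_const_mult mult.assoc)

definition monomials :: "'k fps fps set" where
  "monomials = (\<lambda>(i, j). xx ^ i * yy ^ j) ` exponents"

text \<open>Scalars act as multiplication by constant series. This makes linear dimension available
  to bound the length of chains.\<close>

lemma subspace_ideal:
  assumes "ideal N ring_of_type_algebra"
  shows "cf.subspace N"
  using assms by (auto simp: cf.subspace_def ideal_type_algebra_iff)

text \<open>Plays the role of the span of the monomials in the quotient by \<open>J\<close>, without
  forming that quotient.\<close>

definition monomial_span :: "'k fps fps set" where
  "monomial_span = {f. \<exists>g\<in>cf.span monomials. f - g \<in> J}"

lemma subspace_monomial_span: "cf.subspace monomial_span"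
proof (rule cf.subspaceI)
  show "0 \<in> monomial_span" using cf.span_zero J_gens(4) by (auto simp: monomial_span_def intro: bexI[of _ 0])
next
  fix f g assume "f \<in> monomial_span" "g \<in> monomial_span"
  then obtain f' g' where "f' \<in> cf.span monomials" "f - f' \<in> J" "g' \<in> cf.span monomials" "g - g' \<in> J"
    by (auto simp: monomial_span_def)
  then have "f' + g' \<in> cf.span monomials" "(f + g) - (f' + g') \<in> J"
    using cf.span_add J_add[of "f - f'" "g - g'"] by (auto simp: algebra_simps)
  then show "f + g \<in> monomial_span" by (auto simp: monomial_span_def)
next
  fix c f assume "f \<in> monomial_span"
  then obtain f' where "f' \<in> cf.span monomials" "f - f' \<in> J"
    by (auto simp: monomial_span_def)
  then have "fps_const (fps_const c) * f' \<in> cf.span monomials"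
    "fps_const (fps_const c) * f - fps_const (fps_const c) * f' \<in> J"
    using cf.span_scale J_mult[of "f - f'" "fps_const (fps_const c)"]
    by (simp_all add: right_diff_distrib)
  then show "fps_const (fps_const c) * f \<in> monomial_span" by (auto simp: monomial_span_def)
qed

lemma monomial_span_cong:
  assumes "f - g \<in> J" "g \<in> monomial_span"
  shows "f \<in> monomial_span"
proof -
  obtain h where "h \<in> cf.span monomials" "g - h \<in> J" using assms by (auto simp: monomial_span_def)
  moreover have "(f - g) + (g - h) \<in> J" using assms calculation by (intro J_add)
  ultimately show ?thesis by (auto simp: monomial_span_def)
qed

lemma J_in_monomial_span: "f \<in> J \<Longrightarrow> f \<in> monomial_span"
  using monomial_span_cong[of f 0] cf.subspace_0[OF subspace_monomial_span] by simp

text \<open>Trading \<open>yy ^ n\<close> for \<open>xx ^ n\<close> lowers \<open>c\<close> below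
  \<open>n\<close> while \<open>a\<close> grows, hence \<open>arbitrary: a\<close>. What then lies
  outside \<open>exponents\<close> is divisible by \<open>xx ^ (M + b)\<close> or by
  \<open>xx ^ M * yy ^ b\<close>, and both are in \<open>J\<close>.\<close>

lemma monomial_in_monomial_span: "xx ^ a * yy ^ c \<in> monomial_span"
proof (induction c arbitrary: a rule: less_induct)
  case (less c)
  show ?case
  proof (cases "c < n")
    case False
    then have c: "yy ^ c = yy ^ (c - n) * (yy ^ n :: 'k fps fps)" by (simp flip: power_add)
    have "xx ^ a * yy ^ c - xx ^ (a + n) * yy ^ (c - n)
           = (- (xx ^ a * yy ^ (c - n))) * (xx ^ n - yy ^ n :: 'k fps fps)"
      by (simp add: c power_add algebra_simps)
    then have "xx ^ a * yy ^ c - xx ^ (a + n) * yy ^ (c - n) \<in> J"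
      using J_gens(1) by metis
    then show ?thesis
      by (rule monomial_span_cong) (use less False n_pos in simp)
  next
    case c: True
    consider "(a, c) \<in> exponents" | "a \<ge> M + b" | "c \<ge> b" "a \<ge> M"
      using c by (fastforce simp: exponents_def)
    then show ?thesis
    proof cases
      case 1
      then have "xx ^ a * yy ^ c \<in> cf.span monomials"
        by (intro cf.span_base) (auto simp: monomials_def)
      then show ?thesis using J_gens(4) by (force simp: monomial_span_def)
    next
      case 2
      then have "xx ^ a * yy ^ c = xx ^ (a - (M + b)) * yy ^ c * (xx ^ (M + b) :: 'k fps fps)"
        by (simp add: mult.commute mult.left_commute flip: power_add)
      then show ?thesis using J_gens(2) J_in_monomial_span by metis
    next
      case 3
      obtain k where k: "M = n * k" using dvd by blast
      \<comment> \<open>As \<open>n\<close> divides \<open>M\<close>, this difference contains a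
        difference of \<open>k\<close>-th powers of \<open>xx ^ n\<close> and \<open>yy ^ n\<close>,
        a multiple of \<open>xx ^ n - yy ^ n\<close>.\<close>
      have "xx ^ M * yy ^ b - yy ^ (M + b) = (xx ^ n) ^ k * yy ^ b - (yy ^ n) ^ k * (yy ^ b :: 'k fps fps)"
        by (simp add: k power_add power_mult)
      also have "\<dots> = ((xx ^ n) ^ k - (yy ^ n) ^ k) * yy ^ b"
        by (simp add: left_diff_distrib)
      also have "\<dots> \<in> J"
      proof -
        obtain h where "(xx ^ n) ^ k - (yy ^ n) ^ k = (xx ^ n - yy ^ n) * (h :: 'k fps fps)"
          using power_diff_sumr2 by blast
        then have "((xx ^ n) ^ k - (yy ^ n) ^ k) * yy ^ b = (h * yy ^ b) * (xx ^ n - yy ^ n)"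
          by (simp add: mult_ac)
        then show ?thesis using J_gens(1) by metis
      qed
      finally have "(xx ^ M * yy ^ b - yy ^ (M + b)) + 1 * yy ^ (M + b) \<in> J"
        using J_gens(3) by (intro J_add)
      then have "xx ^ M * yy ^ b \<in> J" by simp
      then have "xx ^ (a - M) * yy ^ (c - b) * (xx ^ M * yy ^ b) \<in> J"
        by (rule J_mult)
      moreover have "xx ^ (a - M) * yy ^ (c - b) * (xx ^ M * yy ^ b) =
          (xx ^ (a - M) * xx ^ M) * (yy ^ (c - b) * (yy ^ b :: 'k fps fps))"
        by (simp add: mult_ac)
      moreover have "\<dots> = xx ^ a * yy ^ c"
        using 3 by (simp flip: power_add)
      ultimately show ?thesis using J_in_monomial_span by metis
    qed
  qed
qed

text \<open>All but finitely many coefficients are absorbed by \<open>J\<close>: \<open>g\<close>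
  keeps those with both exponents below \<open>M + b\<close>.\<close>

lemma monomial_span_UNIV: "f \<in> monomial_span"
proof -
  let ?q = "M + b"
  define g where "g = (\<Sum>c<?q. \<Sum>a<?q. fps_const (fps_const (f $ c $ a)) * (xx ^ a * yy ^ c))"
  \<comment> \<open>The part with small y-exponent and large x-exponent, divided by the power of
    \<open>xx\<close>; the rest is a multiple of the power of \<open>yy\<close>.\<close>
  define h where "h = Abs_fps (\<lambda>c. if c < ?q then fps_shift ?q (f $ c) else 0)"
  have "g \<in> monomial_span"
    unfolding g_def
    by (intro cf.subspace_sum[OF subspace_monomial_span]
        cf.subspace_scale[OF subspace_monomial_span] monomial_in_monomial_span)
  moreover have "f - g = h * xx ^ ?q + fps_shift ?q f * yy ^ ?q"
  proof (rule fps_ext, rule fps_ext)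
    fix j i
    have "g $ j $ i = (\<Sum>c<?q. \<Sum>a<?q. f $ c $ a * (xx ^ a * yy ^ c * 1) $ j $ i)"
      by (simp add: g_def fps_sum_nth)
    also have "\<dots> = (\<Sum>c<?q. \<Sum>a<?q. if j = c then (if i = a then f $ c $ a else 0) else 0)"
      unfolding monomial_mult_nth by (intro sum.cong) auto
    also have "\<dots> = (\<Sum>c<?q. if j = c then (\<Sum>a<?q. if i = a then f $ c $ a else 0) else 0)"
      by (intro sum.cong) auto
    also have "\<dots> = (if j < ?q \<and> i < ?q then f $ j $ i else 0)"
      by (simp add: sum.delta)
    finally have g: "g $ j $ i = (if j < ?q \<and> i < ?q then f $ j $ i else 0)" .
    have 1: "(h * xx ^ ?q) $ j $ i = (if j < ?q \<and> ?q \<le> i then f $ j $ i else 0)"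
      using monomial_mult_nth[of ?q 0 h j i] by (simp add: mult.commute h_def)
    have 2: "(fps_shift ?q f * yy ^ ?q) $ j $ i = (if ?q \<le> j then f $ j $ i else 0)"
      using monomial_mult_nth[of 0 ?q "fps_shift ?q f" j i] by (simp add: mult.commute)
    show "(f - g) $ j $ i = (h * xx ^ ?q + fps_shift ?q f * yy ^ ?q) $ j $ i"
      unfolding fps_sub_nth fps_add_nth g 1 2 by auto
  qed
  moreover have "h * xx ^ ?q + fps_shift ?q f * yy ^ ?q \<in> J"
    by (intro J_add J_gens)
  ultimately show ?thesis using monomial_span_cong by metis
qed

text \<open>Each strict inclusion supplies a new vector outside the subspace reached so far, so a
  chain of length \<open>l\<close> gives \<open>l\<close> independent vectors in the span of the
  monomials.\<close>

lemma ideal_chain_length_le: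
  assumes "ideal_chain ring_of_type_algebra J l N"
  shows "l \<le> card exponents"
proof -
  have id: "ideal (N i) ring_of_type_algebra" "J \<subseteq> N i" if "i \<le> l" for i
    using assms that by (auto simp: ideal_chain_def)
  have sub: "cf.subspace (N i)" if "i \<le> l" for i
    using id[OF that] subspace_ideal by blast
  \<comment> \<open>A witness \<open>g\<close> of strictness may be replaced by \<open>h\<close>,
    since \<open>g - h\<close> lies in \<open>J\<close> and hence in both ideals.\<close>
  have "\<exists>h. h \<in> cf.span monomials \<and> h \<in> N (Suc i) \<and> h \<notin> N i" if i: "i < l" for i
  proof -
    obtain g where g: "g \<in> N (Suc i)" "g \<notin> N i"
      using assms i unfolding ideal_chain_def by blast
    obtain h where h: "h \<in> cf.span monomials" "g - h \<in> J"
      using monomial_span_UNIV[of g] by (auto simp: monomial_span_def)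
    have "g - (g - h) \<in> N (Suc i)"
      by (rule cf.subspace_diff[OF sub g(1)]) (use h id[of "Suc i"] i in auto)
    moreover have "h \<notin> N i"
    proof
      assume "h \<in> N i"
      then have "(g - h) + h \<in> N i"
        by (intro cf.subspace_add sub) (use h id[of i] i in auto)
      then show False using g by simp
    qed
    ultimately show ?thesis using h by auto
  qed
  then obtain h where h: "\<And>i. i < l \<Longrightarrow> h i \<in> cf.span monomials \<and> h i \<in> N (Suc i) \<and> h i \<notin> N i"
    by metis
  have "m \<le> l \<Longrightarrow> h ` {..<m} \<subseteq> N m \<and> cf.independent (h ` {..<m}) \<and> card (h ` {..<m}) = m" for m
  proof (induction m)
    case 0
    then show ?case by (simp add: cf.independent_empty)
  next
    case (Suc m)
    then have IH: "h ` {..<m} \<subseteq> N m" "cf.independent (h ` {..<m})" "card (h ` {..<m}) = m"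
      by auto
    have "cf.span (h ` {..<m}) \<subseteq> N m"
      using IH(1) sub[of m] Suc.prems by (intro cf.span_minimal) auto
    then have notin: "h m \<notin> cf.span (h ` {..<m})"
      using h[of m] Suc.prems by auto
    then have "h m \<notin> h ` {..<m}" by (rule contrapos_nn) (rule cf.span_base)
    then have "card (insert (h m) (h ` {..<m})) = Suc m"
      using IH(3) by simp
    moreover have "cf.independent (insert (h m) (h ` {..<m}))"
      by (rule cf.independent_insertI[OF notin IH(2)])
    moreover have "insert (h m) (h ` {..<m}) \<subseteq> N (Suc m)"
    proof -
      have m: "m < l" using Suc.prems by simp
      have "N m \<subseteq> N (Suc m)" using assms m unfolding ideal_chain_def by blast
      then show ?thesis using IH(1) h[OF m] by blast
    qed
    ultimately show ?case
      by (simp only: lessThan_Suc image_insert) blast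
  qed
  then have ind: "cf.independent (h ` {..<l})" "card (h ` {..<l}) = l" by auto
  have "card (h ` {..<l}) \<le> card monomials"
    using cf.independent_span_bound[OF _ ind(1), of monomials] h finite_exponents
    by (auto simp: monomials_def)
  also have "\<dots> \<le> card exponents"
    unfolding monomials_def by (rule card_image_le[OF finite_exponents])
  finally show ?thesis using ind by simp
qed

lemma Sup_ideal_chain_length:
  "Sup {enat l | l. \<exists>N. ideal_chain ring_of_type_algebra J l N} = enat (M * n + b * b)"
proof (rule antisym)
  show "Sup {enat l | l. \<exists>N. ideal_chain ring_of_type_algebra J l N} \<le> enat (M * n + b * b)"
    using ideal_chain_length_le by (auto intro!: Sup_least simp flip: card_exponents)
  obtain N where "ideal_chain ring_of_type_algebra (diag_ideal exponents) (card exponents) N"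
    using ideal_chain_diag_ideal by blast
  then have "ideal_chain ring_of_type_algebra J (card exponents) N"
    using J_subset_diag_ideal by (auto simp: ideal_chain_def)
  then show "enat (M * n + b * b) \<le> Sup {enat l | l. \<exists>N. ideal_chain ring_of_type_algebra J l N}"
    by (intro Sup_upper) (auto simp flip: card_exponents)
qed

end

subsection \<open>Frobenius powers of the maximal ideal\<close>

lemma ideal_genideal_type_algebra:
  "ideal (Idl\<^bsub>ring_of_type_algebra\<^esub> T) (ring_of_type_algebra :: 'a::comm_ring_1 ring)"
proof -
  interpret A: cring "ring_of_type_algebra :: 'a ring" by rule
  show ?thesis by (rule A.genideal_ideal) (simp add: ring_of_type_algebra_def)
qed

lemma coset_power_type_algebra:
  fixes P :: "'a::comm_ring_1 set" and f :: 'a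
  assumes "ideal P ring_of_type_algebra"
  shows "(P +>\<^bsub>ring_of_type_algebra\<^esub> f) [^]\<^bsub>ring_of_type_algebra Quot P\<^esub> (k::nat) =
           P +>\<^bsub>ring_of_type_algebra\<^esub> f ^ k"
proof -
  let ?A = "ring_of_type_algebra :: 'a ring"
  interpret ideal P ?A by fact
  interpret Q: ring "?A Quot P" by (rule quotient_is_ring)
  interpret h: ring_hom_ring ?A "?A Quot P" "(+>\<^bsub>?A\<^esub>) P" by (rule rcos_ring_hom_ring)
  have A: "x \<in> carrier ?A" "x \<otimes>\<^bsub>?A\<^esub> y = x * y" "\<one>\<^bsub>?A\<^esub> = 1" for x y
    by (simp_all add: ring_of_type_algebra_def)
  show ?thesis
  proof (induction k)
    case 0
    then show ?case using h.hom_one by (simp add: A)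
  next
    case (Suc k)
    then show ?case using h.hom_mult[OF A(1) A(1), of "f ^ k" f] by (simp add: A mult.commute)
  qed
qed

text \<open>The criterion that a series is a unit once its constant coefficient is, applied first in
  x and then in y.\<close>

lemma fps_fps_unit:
  fixes f :: "'k::field fps fps"
  assumes "f $ 0 $ 0 \<noteq> 0"
  shows "\<exists>g. g * f = 1"
proof -
  have "f $ 0 * inverse (f $ 0) = 1"
    using assms by (rule inverse_mult_eq_1')
  then have "\<exists>k. 1 = f $ 0 * k" by metis
  then show ?thesis
    using fps_is_left_unit_iff_zeroth_is_left_unit[of f] by (metis mult.commute)
qed

text \<open>A series with nonzero constant term is a unit, so \<open>\<mm>\<close> lies in the image
  of the series without constant term. That image is a proper ideal, and maximality gives
  equality.\<close>

lemma maximalideal_power_series_quotient: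
  fixes \<mm> :: "'k::field fps fps set set"
  assumes n: "n > 0" and m: "maximalideal \<mm> (power_series_quotient n)"
  defines "P \<equiv> Idl\<^bsub>ring_of_type_algebra\<^esub> {xx ^ n - yy ^ n :: 'k fps fps}"
  shows "\<mm> = (+>\<^bsub>ring_of_type_algebra\<^esub>) P ` {f. f $ 0 $ 0 = 0}"
proof -
  let ?A = "ring_of_type_algebra :: 'k fps fps ring"
  let ?h = "(+>\<^bsub>?A\<^esub>) P"
  define \<nn> where "\<nn> = {f :: 'k fps fps. f $ 0 $ 0 = 0}"
  interpret A: cring ?A by rule
  have P: "ideal P ?A" unfolding P_def by (rule ideal_genideal_type_algebra)
  have R: "power_series_quotient n = ?A Quot P" by (simp add: power_series_quotient_def P_def)
  interpret m: maximalideal \<mm> "?A Quot P" using m by (simp only: R)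
  interpret Q: ring "?A Quot P" by (rule ideal.quotient_is_ring[OF P])
  have carrA: "carrier ?A = UNIV" "\<one>\<^bsub>?A\<^esub> = 1" by (simp_all add: ring_of_type_algebra_def)
  have \<nn>: "ideal \<nn> ?A"
    by (simp add: ideal_type_algebra_iff \<nn>_def fps_mult_nth_0)
  have "P \<subseteq> \<nn>"
    unfolding P_def
    by (rule A.genideal_minimal[OF \<nn>]) (use n in \<open>simp add: \<nn>_def fps_const_power\<close>)
  then have up: "\<Union>(?h ` \<nn>) = \<nn>"
    using A.ideal_incl_iff[OF P \<nn>] by blast
  have mem: "f \<in> \<Union>L \<longleftrightarrow> ?h f \<in> L" if "ideal L (?A Quot P)" for f L
    by (rule A.canonical_proj_vimage_mem_iff[OF P])
       (use that carrA additive_subgroup.a_subset[OF ideal.axioms(1)] in auto)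
  have one: "?h 1 = \<one>\<^bsub>?A Quot P\<^esub>"
    using carrA by (simp add: FactRing_def)
  have h\<nn>: "ideal (?h ` \<nn>) (?A Quot P)"
    by (rule A.ring_ideal_imp_quot_ideal[OF P \<nn>])
  have "1 \<notin> \<nn>" by (simp add: \<nn>_def)
  then have "?h ` \<nn> \<noteq> carrier (?A Quot P)"
    using mem[OF h\<nn>, of 1] up one by auto
  moreover have "\<mm> \<subseteq> ?h ` \<nn>"
  proof
    fix r assume r: "r \<in> \<mm>"
    then have "r \<in> carrier (?A Quot P)" using m.a_subset by blast
    then obtain f where f: "r = ?h f" by (auto simp: FactRing_def A_RCOSETS_def')
    have "f \<in> \<nn>"
    proof (rule ccontr)
      assume "f \<notin> \<nn>"
      then obtain g where g: "g * f = 1" using fps_fps_unit by (auto simp: \<nn>_def)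
      have "ideal (\<Union>\<mm>) ?A"
        by (rule A.quot_ideal_imp_ring_ideal[OF P m.is_ideal])
      moreover have "f \<in> \<Union>\<mm>" using mem[OF m.is_ideal] r f by simp
      ultimately have "g * f \<in> \<Union>\<mm>" by (rule ideal_type_algebra_mult)
      then have "\<one>\<^bsub>?A Quot P\<^esub> \<in> \<mm>" using mem[OF m.is_ideal] g one by simp
      then show False using m.one_imp_carrier m.I_notcarr by blast
    qed
    then show "r \<in> ?h ` \<nn>" using f by blast
  qed
  moreover have "?h ` \<nn> \<subseteq> carrier (?A Quot P)"
    using additive_subgroup.a_subset[OF ideal.axioms(1)[OF h\<nn>]] .
  ultimately show ?thesis
    using m.I_maximal[OF h\<nn>] unfolding \<nn>_def by blast
qed

section \<open>Pulling the Frobenius power back to \<open>J\<close>\<close>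

context diagonal_truncation
begin

lemma frobenius_power_in_J:
  fixes f :: "'k fps fps"
  assumes p: "prime p" "CHAR('k) = p" and q: "p ^ e = M + b" and f: "f $ 0 $ 0 = 0"
  shows "f ^ (p ^ e) \<in> J"
proof -
  \<comment> \<open>Splits \<open>f\<close> as x times a series plus y times a series; additivity of
    the power map then leaves only multiples of the two pure powers.\<close>
  have 1: "f $ 0 = fps_X * fps_shift 1 (f $ 0)"
    by (rule fps_ext) (use f in \<open>simp add: fps_X_mult_nth\<close>)
  have "f = fps_const (f $ 0) + yy * fps_shift 1 f"
    by (rule fps_ext) (simp add: fps_X_mult_nth)
  also have "fps_const (f $ 0) = xx * fps_const (fps_shift 1 (f $ 0))"
    by (subst 1) (simp only: fps_const_mult)
  finally have "f ^ (p ^ e) =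
      (xx * fps_const (fps_shift 1 (f $ 0)) + yy * fps_shift 1 f) ^ (p ^ e)"
    by simp
  also have "\<dots> = (xx * fps_const (fps_shift 1 (f $ 0))) ^ (p ^ e) + (yy * fps_shift 1 f) ^ (p ^ e)"
    by (rule freshmans_dream') (use p in simp_all)
  also have "\<dots> = fps_const (fps_shift 1 (f $ 0)) ^ (p ^ e) * xx ^ (M + b)
      + fps_shift 1 f ^ (p ^ e) * yy ^ (M + b)"
    by (simp only: q power_mult_distrib mult.commute)
  also have "\<dots> \<in> J" by (intro J_add J_gens)
  finally show ?thesis .
qed

text \<open>One inclusion holds because every generator is the coset of some
  \<open>f ^ (p ^ e)\<close> in \<open>J\<close>. For the other, x and y have no constant term,
  which gives the two pure powers, and \<open>xx ^ n - yy ^ n\<close> lies over zero.\<close>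

lemma Union_frobenius_power:
  fixes \<mm> :: "'k fps fps set set"
  assumes p: "prime p" "CHAR('k) = p" and q: "p ^ e = M + b"
    and m: "maximalideal \<mm> (power_series_quotient n)"
  shows "\<Union>(frobenius_power (power_series_quotient n) \<mm> (p ^ e)) = J"
    and "ideal (frobenius_power (power_series_quotient n) \<mm> (p ^ e)) (power_series_quotient n)"
proof -
  let ?A = "ring_of_type_algebra :: 'k fps fps ring"
  define P where "P = Idl\<^bsub>?A\<^esub> {xx ^ n - yy ^ n}"
  let ?h = "(+>\<^bsub>?A\<^esub>) P"
  interpret A: cring ?A by rule
  have P: "ideal P ?A" unfolding P_def by (rule ideal_genideal_type_algebra)
  have R: "power_series_quotient n = ?A Quot P" by (simp add: power_series_quotient_def P_def)
  interpret Q: ring "?A Quot P" by (rule ideal.quotient_is_ring[OF P])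
  have carrA: "carrier ?A = UNIV" by (simp add: ring_of_type_algebra_def)
  have m_eq: "\<mm> = ?h ` {f. f $ 0 $ 0 = 0}"
    unfolding P_def by (rule maximalideal_power_series_quotient[OF n_pos m])
  define G where "G = {r [^]\<^bsub>?A Quot P\<^esub> (p ^ e) | r. r \<in> \<mm>}"
  have G: "G = ?h ` {f ^ (p ^ e) | f. f $ 0 $ 0 = 0}"
    unfolding G_def m_eq using coset_power_type_algebra[OF P] by auto
  define F where "F = frobenius_power (power_series_quotient n) \<mm> (p ^ e)"
  have F_eq: "F = Idl\<^bsub>?A Quot P\<^esub> G" by (simp add: F_def frobenius_power_def G_def R)
  have G_carr: "G \<subseteq> carrier (?A Quot P)"
    unfolding G carrA by (auto simp: FactRing_def A_RCOSETS_def' carrA)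
  have F: "ideal F (?A Quot P)" unfolding F_eq by (rule Q.genideal_ideal[OF G_carr])
  then show "ideal (frobenius_power (power_series_quotient n) \<mm> (p ^ e)) (power_series_quotient n)"
    by (simp only: F_def R)
  have mem: "f \<in> \<Union>F \<longleftrightarrow> ?h f \<in> F" for f
    by (rule A.canonical_proj_vimage_mem_iff[OF P])
       (use carrA additive_subgroup.a_subset[OF ideal.axioms(1)[OF F]] in auto)
  have UF: "ideal (\<Union>F) ?A" by (rule A.quot_ideal_imp_ring_ideal[OF P F])
  have "xx ^ n - yy ^ n \<in> J" using J_gens(1)[of 1] by simp
  then have PJ: "P \<subseteq> J" unfolding P_def by (intro A.genideal_minimal[OF ideal_J]) simp
  then have up: "\<Union>(?h ` J) = J" using A.ideal_incl_iff[OF P ideal_J] by blast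
  have "F \<subseteq> ?h ` J"
    unfolding F_eq
    by (rule Q.genideal_minimal[OF A.ring_ideal_imp_quot_ideal[OF P ideal_J]])
       (auto simp: G intro!: imageI frobenius_power_in_J[OF p q])
  then have 1: "\<Union>F \<subseteq> J" using up by blast
  have "f ^ (p ^ e) \<in> \<Union>F" if "f $ 0 $ 0 = 0" for f
  proof -
    have "?h (f ^ (p ^ e)) \<in> G" unfolding G using that by (intro imageI) blast
    then show ?thesis unfolding mem unfolding F_eq using Q.genideal_self[OF G_carr] by (rule set_rev_mp)
  qed
  from this[of xx] this[of yy] have gens: "xx ^ (M + b) \<in> \<Union>F" "yy ^ (M + b) \<in> \<Union>F"
    by (simp_all add: q)
  have "xx ^ n - yy ^ n \<in> P"
    unfolding P_def using A.genideal_self[of "{xx ^ n - yy ^ n}"] carrA by simp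
  then have "?h (xx ^ n - yy ^ n) = \<zero>\<^bsub>?A Quot P\<^esub>"
    using A.a_rcos_zero[OF P] by (simp add: FactRing_def)
  then have "xx ^ n - yy ^ n \<in> \<Union>F"
    unfolding mem using additive_subgroup.zero_closed[OF ideal.axioms(1)[OF F]] by simp
  then have "u * (xx ^ n - yy ^ n) + v * xx ^ (M + b) + w * yy ^ (M + b) \<in> \<Union>F" for u v w
    using gens by (intro ideal_type_algebra_add[OF UF] ideal_type_algebra_mult[OF UF])
  then have "J \<subseteq> \<Union>F" unfolding J_def by blast
  with 1 show "\<Union>(frobenius_power (power_series_quotient n) \<mm> (p ^ e)) = J"
    by (simp add: F_def)
qed

lemma hilbert_kunz_power_series_quotient:
  fixes \<mm> :: "'k fps fps set set"
  assumes "prime p" "CHAR('k) = p" "p ^ e = M + b" "maximalideal \<mm> (power_series_quotient n)"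
  shows "hilbert_kunz (power_series_quotient n) \<mm> p e = enat (M * n + b * b)"
  using module_length_quotient_of_quotient[OF cring_from_type_algebra ideal_genideal_type_algebra
      Union_frobenius_power(2)[OF assms, unfolded power_series_quotient_def]]
    Union_frobenius_power(1)[OF assms] Sup_ideal_chain_length
  by (simp add: hilbert_kunz_def power_series_quotient_def)

end

theorem theorem1:
  fixes p n :: nat
    and R :: "('k::field fps fps set) ring"
    and \<mm> :: "'k fps fps set set"
    and \<pi> \<omega> :: nat
  assumes "prime p" and "CHAR('k) = p"
    and "n > 1" and "\<not> p dvd n"
    and "R = power_series_quotient n"
    and "maximalideal \<mm> R"
    and "\<pi> = eventual_period (hk_phi R \<mm> p)"
    and "\<omega> = unit_order_mod n p"
  shows "(\<forall>(e::nat) (b::int). [int p ^ e = b] (mod int n) \<and> 1 \<le> b \<and> b \<le> int n - 1 \<longrightarrow>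
            (\<exists>l. hilbert_kunz R \<mm> p e = enat l \<and>
                 int l = int n * int p ^ e - b * (int n - b))) \<and>
         (immediately_periodic (hk_phi R \<mm> p) \<and> real \<pi> \<in> {real \<omega> / 2, real \<omega>}) \<and>
         (real \<pi> = real \<omega> / 2 \<longleftrightarrow> even \<omega> \<and> [int p ^ (\<omega> div 2) = -1] (mod int n))"
proof -
  have cop: "coprime p n" using assms(1,4) by (rule prime_imp_coprime)
  define r where "r e = int p ^ e mod int n" for e
  \<comment> \<open>The candidate for \<open>hk_phi\<close>, identified with it at the end by
    uniqueness of the decomposition.\<close>
  define \<phi> where "\<phi> e = r e * (int n - r e)" for e
  define Q where "Q d \<longleftrightarrow> [int p ^ d = 1] (mod int n) \<or> [int p ^ d = - 1] (mod int n)" for d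
  have hk: "\<exists>l. hilbert_kunz R \<mm> p e = enat l \<and> int l = int n * int p ^ e - \<phi> e" for e
  proof -
    define b where "b = p ^ e mod n"
    define M where "M = p ^ e - b"
    have q: "p ^ e = M + b" by (simp add: M_def b_def)
    \<comment> \<open>Ensures that the remainder \<open>b\<close> is positive, as the locale
      requires.\<close>
    have "\<not> n dvd p ^ e"
    proof
      assume "n dvd p ^ e"
      moreover have "coprime n (p ^ e)" using cop by (simp add: coprime_commute)
      ultimately show False using assms(3) coprime_common_divisor_nat[of n "p ^ e" n] by simp
    qed
    then have "b > 0" by (simp add: b_def dvd_eq_mod_eq_0)
    then interpret diagonal_truncation n M b "TYPE('k)"
      by unfold_locales (use assms(3) in \<open>auto simp: M_def b_def\<close>)
    have "hilbert_kunz R \<mm> p e = enat (M * n + b * b)"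
      using hilbert_kunz_power_series_quotient[OF assms(1,2) q] assms(5,6) by simp
    moreover have r: "r e = int b" by (simp add: r_def b_def of_nat_mod)
    have "int (M * n + b * b) = int n * int p ^ e - \<phi> e"
      unfolding \<phi>_def r of_nat_power[symmetric] q by (simp add: algebra_simps)
    ultimately show ?thesis by blast
  qed
  \<comment> \<open>Equal values mean that \<open>p ^ (e + d)\<close> is congruent to plus or minus
    \<open>p ^ e\<close>, and the factor \<open>p ^ e\<close> cancels because it is a unit modulo
    \<open>n\<close>.\<close>
  have shift: "\<phi> (e + d) = \<phi> e \<longleftrightarrow> Q d" for e d
  proof -
    have "coprime (int p ^ e) (int n)" using cop by simp
    from cong_mult_lcancel[OF this, of "int p ^ d" 1] cong_mult_lcancel[OF this, of "int p ^ d" "-1"]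
    show ?thesis
      unfolding \<phi>_def r_def Q_def power_add
      by (subst mod_times_complement_eq_iff) (use assms(3) in simp_all)
  qed
  have "Q \<omega>" "\<omega> > 0"
    using unit_order_mod_dvd_iff[OF assms(3) cop, of \<omega>] unit_order_mod_pos[OF assms(3) cop]
    by (simp_all add: Q_def assms(8))
  note per = eventual_period_shift_invariant[of \<phi> Q, OF shift this]
  have "hk_decomposition R \<mm> p n \<phi>"
    using hk per(2) assms(3) by (simp add: hk_decomposition_def immediately_periodic_def)
  then have \<phi>: "hk_phi R \<mm> p = \<phi>"
    unfolding hk_phi_def using hk_decomposition_unique[OF prime_gt_1_nat[OF assms(1)]]
    by (intro the_equality) blast+
  have \<pi>: "\<pi> = (LEAST d. d > 0 \<and> Q d)" using assms(7) per(1) \<phi> by simp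
  have 1: "\<exists>l. hilbert_kunz R \<mm> p e = enat l \<and> int l = int n * int p ^ e - b * (int n - b)"
    if "[int p ^ e = b] (mod int n)" "1 \<le> b" "b \<le> int n - 1" for e b
  proof -
    have "r e = b" using that by (simp add: r_def cong_def)
    then show ?thesis using hk[of e] by (simp add: \<phi>_def)
  qed
  show ?thesis
    using 1 per(2) least_exponent_plus_minus_one[OF assms(3) cop]
    unfolding \<phi> assms(8) \<pi> Q_def by blast
qed

end
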